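(* Let $n\ge 2$ be an integer and let $\mathfrak{A}$ be a $2$-torsion free unital ring with a nontrivial idempotent $e_1$; put $e_2=1-e_1$. Assume that for all $t\in\mathfrak{A}$: (i) if $e_1te_1\cdot e_1\mathfrak{A}e_2=\{0\}=e_2\mathfrak{A}e_1\cdot e_1te_1$, then $e_1te_1=0$; and (ii) if $e_1\mathfrak{A}e_2\cdot e_2te_2=\{0\}=e_2te_2\cdot e_2\mathfrak{A}e_1$, then $e_2te_2=0$. Then every multiplicative generalized Jordan $n$-derivation $\Delta:\mathfrak{A}\rightarrow\mathfrak{A}$ is additive. More precisely, there exist $\mu\in\mathcal{Z}(\mathfrak{A})$ and a Jordan $n$-derivation $\delta:\mathfrak{A}\rightarrow\mathfrak{A}$ such that $\Delta(t)=\mu t+\delta(t)$ for all $t\in\mathfrak{A}$.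
   Context: Rings are associative with identity; $\mathcal{Z}(\mathfrak{A})$ is the center of $\mathfrak{A}$. A ring is $2$-torsion free if $2t=0$ implies $t=0$. An idempotent is nontrivial if it is different from $0$ and $1$. The Jordan product is $t_1\circ t_2=t_1t_2+t_2t_1$. Set $q_1(t_1)=t_1$ and $q_n(t_1,\ldots,t_n)=q_{n-1}(t_1,\ldots,t_{n-1})\circ t_n$ for $n\ge 2$. A map $\delta:\mathfrak{A}\to\mathfrak{A}$ (not assumed additive) is a multiplicative Jordan $n$-derivation if $\delta(q_n(t_1,\ldots,t_n))=\sum_{i=1}^n q_n(t_1,\ldots,t_{i-1},\delta(t_i),t_{i+1},\ldots,t_n)$ for all $t_1,\ldots,t_n\in\mathfrak{A}$; it is a Jordan $n$-derivation if it is moreover additive. A map $\Delta:\mathfrak{A}\to\mathfrak{A}$ (not assumed additive) is a multiplicative generalized Jordan $n$-derivation if there exists a multiplicative Jordan $n$-derivation $\delta:\mathfrak{A}\to\mathfrak{A}$ (not assumed additive) such that $\Delta(q_n(t_1,\ldots,t_n))=q_n(\Delta(t_1),t_2,\ldots,t_n)+\sum_{i=2}^n q_n(t_1,\ldots,t_{i-1},\delta(t_i),t_{i+1},\ldots,t_n)$ for all $t_1,\ldots,t_n\in\mathfrak{A}$. *)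

theory Defs
  imports Complex_Main
begin

definition jordan_prod :: "'a::ring_1 \<Rightarrow> 'a \<Rightarrow> 'a"  (infixl "\<circ>\<^sub>J" 70)
  where "x \<circ>\<^sub>J y = x * y + y * x"

text \<open>\<open>jordan_poly n t\<close> is $q_n(t_1,\ldots,t_n)$; the tuple is the restriction of
  \<open>t\<close> to \<open>{1..n}\<close>, other values of \<open>t\<close> are irrelevant. The value at \<open>n = 0\<close> is a
  placeholder, since $q_n$ is only defined for $n \ge 1$.\<close>

fun jordan_poly :: "nat \<Rightarrow> (nat \<Rightarrow> 'a::ring_1) \<Rightarrow> 'a" where
  "jordan_poly 0 t = 0"
| "jordan_poly (Suc 0) t = t 1"
| "jordan_poly (Suc (Suc n)) t = jordan_poly (Suc n) t \<circ>\<^sub>J t (Suc (Suc n))"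

definition mult_jordan_derivation :: "nat \<Rightarrow> ('a::ring_1 \<Rightarrow> 'a) \<Rightarrow> bool" where
  "mult_jordan_derivation n \<delta> \<longleftrightarrow>
    (\<forall>t. \<delta> (jordan_poly n t) = (\<Sum>i = 1..n. jordan_poly n (t(i := \<delta> (t i)))))"

definition jordan_derivation :: "nat \<Rightarrow> ('a::ring_1 \<Rightarrow> 'a) \<Rightarrow> bool" where
  "jordan_derivation n \<delta> \<longleftrightarrow> mult_jordan_derivation n \<delta> \<and> Modules.additive \<delta>"

definition mult_gen_jordan_derivation :: "nat \<Rightarrow> ('a::ring_1 \<Rightarrow> 'a) \<Rightarrow> bool" where
  "mult_gen_jordan_derivation n \<Delta> \<longleftrightarrow>
    (\<exists>\<delta>. mult_jordan_derivation n \<delta> \<and>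
      (\<forall>t. \<Delta> (jordan_poly n t) =
        jordan_poly n (t(1 := \<Delta> (t 1))) + (\<Sum>i = 2..n. jordan_poly n (t(i := \<delta> (t i))))))"

definition ring_center :: "'a::ring_1 set" where
  "ring_center = {z. \<forall>x. z * x = x * z}"

text \<open>The set $e \mathfrak{A} f$.\<close>

definition peirce :: "'a::ring_1 \<Rightarrow> 'a \<Rightarrow> 'a set" where
  "peirce e f = {e * a * f | a. True}"

end

theory Submission
  imports Defs
begin

text \<open>The argument splits \<open>\<Delta>\<close> as \<open>\<delta> + D\<close> with \<open>D = \<Delta> - \<delta>\<close>, where \<open>\<delta>\<close> is the multiplicative Jordan
  derivation that accompanies \<open>\<Delta>\<close>; the two parts are handled independently.

  Additivity of \<open>\<delta>\<close> is measured by the defect \<open>U x y = \<delta> (x + y) - \<delta> x - \<delta> y\<close>. The derivation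
  rule makes \<open>U\<close> equivariant: if \<open>L\<close> is the operation \<open>x \<mapsto> q\<^sub>n(x, t\<^sub>2, \<dots>, t\<^sub>n)\<close>, then
  \<open>U (L x) (L y) = L (U x y)\<close> (\<open>additivity_defect_jordan_poly\<close>). Since \<open>\<delta> 0 = 0\<close>, an \<open>L\<close> that
  annihilates \<open>x\<close> or \<open>y\<close> also annihilates \<open>U x y\<close>. Filling the slots \<open>2, \<dots>, n\<close> with \<open>e\<close>, with
  \<open>f = 1 - e\<close> or with \<open>e - f\<close> yields such operations, and by 2-torsion freeness each of them is
  injective on the Peirce components that it does not annihilate. This shows that \<open>U\<close> vanishes
  between elements of different blocks, the blocks being the corners of \<open>e\<close> and \<open>f\<close> and the
  off-diagonal part. Inside the off-diagonal part a sum can be rewritten as a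
  product, because \<open>(e + x) \<circ> (f + y) = x + y + x \<circ> y\<close> for off-diagonal \<open>x\<close> and \<open>y\<close>, with
  \<open>x \<circ> y\<close> diagonal
  (\<open>U_off_diagonal\<close>). Inside a corner, multiplication by an off-diagonal element leads to the
  off-diagonal part, so the defect annihilates all off-diagonal elements and is \<open>0\<close> by
  faithfulness (\<open>U_corner\<close>).

  The map \<open>D\<close> satisfies \<open>D (q\<^sub>n(t\<^sub>1, \<dots>, t\<^sub>n)) = q\<^sub>n(D t\<^sub>1, t\<^sub>2, \<dots>, t\<^sub>n)\<close>. Filling slots with \<open>1\<close>
  gives \<open>2 D x = m \<circ> x\<close> for \<open>m = D 1\<close>, and then that all commutators \<open>m y - y m\<close> are central.
  Central-valued inner derivations vanish under the faithfulness conditions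
  (\<open>central_commutators_imp_central\<close>), hence \<open>m\<close> is central and \<open>D x = m x\<close>.\<close>

section \<open>Jordan polynomials\<close>

(* Otherwise the simplifier turns updates at slot 1 into updates at slot Suc 0, on which the
   lemmas below do not fire. *)
declare One_nat_def [simp del]

lemma jordan_poly_cong:
  assumes "\<And>i. 1 \<le> i \<Longrightarrow> i \<le> n \<Longrightarrow> s i = t i"
  shows "jordan_poly n s = jordan_poly n t"
  using assms by (induction n s rule: jordan_poly.induct) auto

lemma jordan_poly_add:
  assumes "1 \<le> j" "j \<le> n"
  shows "jordan_poly n (t(j := x + y)) = jordan_poly n (t(j := x)) + jordan_poly n (t(j := y))"
  using assms
proof (induction n t rule: jordan_poly.induct)
  case (3 n t)
  show ?case
  proof (cases "j = Suc (Suc n)")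
    case True
    have "jordan_poly (Suc n) (t(j := z)) = jordan_poly (Suc n) t" for z
      by (rule jordan_poly_cong) (use True in auto)
    then show ?thesis
      unfolding True using True
      by (simp add: jordan_prod_def distrib_left distrib_right del: fun_upd_apply)
        (simp add: algebra_simps)
  next
    case False
    then show ?thesis
      using 3 by (simp add: jordan_prod_def algebra_simps)
  qed
qed auto

lemma jordan_poly_diff:
  assumes "1 \<le> j" "j \<le> n"
  shows "jordan_poly n (t(j := x - y)) = jordan_poly n (t(j := x)) - jordan_poly n (t(j := y))"
  using jordan_poly_add[OF assms, of t "x - y" y] by simp

lemma jordan_poly_merge_first_two:
  "jordan_poly (Suc (Suc n)) ((\<lambda>_. c)(1 := x, 2 := y)) =
   jordan_poly (Suc n) ((\<lambda>_. c)(1 := x \<circ>\<^sub>J y))"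
proof (induction n)
  case 0
  then show ?case by (simp add: numeral_2_eq_2)
next
  case (Suc n)
  have "jordan_poly (Suc (Suc (Suc n))) ((\<lambda>_. c)(1 := x, 2 := y)) =
        jordan_poly (Suc (Suc n)) ((\<lambda>_. c)(1 := x, 2 := y)) \<circ>\<^sub>J c"
    by simp
  also have "\<dots> = jordan_poly (Suc n) ((\<lambda>_. c)(1 := x \<circ>\<^sub>J y)) \<circ>\<^sub>J c"
    by (simp only: Suc.IH)
  also have "\<dots> = jordan_poly (Suc (Suc n)) ((\<lambda>_. c)(1 := x \<circ>\<^sub>J y))"
    by simp
  finally show ?case .
qed

lemma jordan_poly_Suc_const:
  "jordan_poly (Suc (Suc k)) ((\<lambda>_. c)(1 := x)) = jordan_poly (Suc k) ((\<lambda>_. c)(1 := x)) \<circ>\<^sub>J c"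
  by simp

lemma jordan_poly_ones: "jordan_poly (Suc n) ((\<lambda>_. 1)(1 := x)) = 2 ^ n * x"
  by (induction n) (simp_all add: jordan_prod_def mult_2 algebra_simps)

section \<open>The additivity defect\<close>

definition additivity_defect :: "('a::ring_1 \<Rightarrow> 'a) \<Rightarrow> 'a \<Rightarrow> 'a \<Rightarrow> 'a"
  where "additivity_defect \<delta> x y = \<delta> (x + y) - \<delta> x - \<delta> y"

text \<open>In the expansion of \<open>\<delta> (q\<^sub>n(\<dots>, x, \<dots>))\<close> every summand except the one that differentiates
  slot \<open>j\<close> is additive in \<open>x\<close> and cancels from the defect. This is how additivity spreads: once
  \<open>\<delta>\<close> is additive on the images of \<open>x\<close> and \<open>y\<close> under \<open>z \<mapsto> q\<^sub>n(\<dots>, z, \<dots>)\<close>, this operation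
  annihilates the defect of \<open>x\<close> and \<open>y\<close>.\<close>

lemma additivity_defect_jordan_poly:
  assumes \<delta>: "mult_jordan_derivation n \<delta>" and j: "1 \<le> j" "j \<le> n"
  shows "additivity_defect \<delta> (jordan_poly n (t(j := x))) (jordan_poly n (t(j := y))) =
         jordan_poly n (t(j := additivity_defect \<delta> x y))"
proof -
  define R where "R z = (\<Sum>i\<in>{1..n} - {j}. jordan_poly n (t(i := \<delta> (t i), j := z)))" for z
  have expand: "\<delta> (jordan_poly n (t(j := z))) = jordan_poly n (t(j := \<delta> z)) + R z" for z
  proof -
    have "\<delta> (jordan_poly n (t(j := z))) =
          (\<Sum>i = 1..n. jordan_poly n ((t(j := z))(i := \<delta> ((t(j := z)) i))))"
      using \<delta> unfolding mult_jordan_derivation_def by blast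
    also have "\<dots> = jordan_poly n (t(j := \<delta> z)) +
        (\<Sum>i\<in>{1..n} - {j}. jordan_poly n ((t(j := z))(i := \<delta> ((t(j := z)) i))))"
      using j by (subst sum.remove[of _ j]) auto
    also have "(\<Sum>i\<in>{1..n} - {j}. jordan_poly n ((t(j := z))(i := \<delta> ((t(j := z)) i)))) = R z"
      unfolding R_def by (rule sum.cong) (auto simp: fun_upd_twist)
    finally show ?thesis .
  qed
  have "R (x + y) = R x + R y"
    unfolding R_def by (simp add: jordan_poly_add[OF j] sum.distrib)
  then show ?thesis
    using expand[of "x + y"] expand[of x] expand[of y]
    by (simp add: additivity_defect_def jordan_poly_add[OF j] jordan_poly_diff[OF j])
qed

lemma mult_jordan_derivation_zero:
  assumes "mult_jordan_derivation n \<delta>" "n \<ge> 2"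
  shows "\<delta> 0 = 0"
proof -
  have vanish: "jordan_poly n t = 0" if "1 \<le> j" "j \<le> n" "t j = 0" for j and t :: "nat \<Rightarrow> 'a"
    using jordan_poly_diff[OF that(1,2), of t 0 0] that(3) by (simp add: fun_upd_idem)
  \<comment> \<open>As \<open>n \<ge> 2\<close>, some slot other than \<open>i\<close> still holds \<open>0\<close>.\<close>
  have "jordan_poly n ((\<lambda>_. 0 :: 'a)(i := z)) = 0" if "i \<in> {1..n}" for i z
    by (rule vanish[of "if i = 1 then 2 else 1"]) (use assms(2) in auto)
  moreover have "jordan_poly n (\<lambda>_. 0 :: 'a) = 0"
    by (rule vanish[of 1]) (use assms(2) in auto)
  moreover have "\<delta> (jordan_poly n (\<lambda>_. 0)) = (\<Sum>i = 1..n. jordan_poly n ((\<lambda>_. 0)(i := \<delta> 0)))"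
    using assms(1) unfolding mult_jordan_derivation_def by blast
  ultimately show ?thesis by simp
qed

section \<open>Peirce components\<close>

text \<open>The left action on one off-diagonal Peirce component and the right action on the other are
  only jointly faithful: each of them alone may kill a nonzero element of the corner.\<close>

definition corner_faithful :: "'a::ring_1 \<Rightarrow> 'a \<Rightarrow> bool" where
  "corner_faithful e f \<longleftrightarrow>
    (\<forall>t. (\<forall>x\<in>peirce e f. e * t * e * x = 0) \<and> (\<forall>x\<in>peirce f e. x * (e * t * e) = 0) \<longrightarrow>
      e * t * e = 0)"

lemma corner_faithfulD:
  assumes "corner_faithful e f"
    and "\<And>a. e * t * e * (e * a * f) = 0" "\<And>a. f * a * e * (e * t * e) = 0"
  shows "e * t * e = 0"
  using assms unfolding corner_faithful_def peirce_def by blast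

lemma peirce_image_eq_zero:
  assumes "\<forall>x\<in>peirce e f. h x = 0"
  shows "{h x | x. x \<in> peirce e f} = {0}"
proof -
  have "e * 0 * f \<in> peirce e f"
    unfolding peirce_def by blast
  with assms show ?thesis by fastforce
qed

locale peirce_pair =
  fixes e f :: "'a::ring_1"
  assumes two_torsion_free: "2 * t = 0 \<Longrightarrow> t = (0 :: 'a)"
    and idem: "e * e = e"
    and complement: "e + f = 1"
begin

lemma f_eq: "f = 1 - e"
  using complement by (simp add: algebra_simps)

lemma ff: "f * f = f" and ef: "e * f = 0" and fe: "f * e = 0"
  by (simp_all add: f_eq algebra_simps idem)

lemma absorb: "e * (e * x) = e * x" "f * (f * x) = f * x" "e * (f * x) = 0" "f * (e * x) = 0"
  by (simp_all flip: mult.assoc add: idem ff ef fe)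

lemmas peirce_simps = idem ff ef fe absorb

lemma swap: "peirce_pair f e"
  by unfold_locales (use two_torsion_free complement in \<open>auto simp: ff add.commute\<close>)

lemma decompose: "x = e * x * e + e * x * f + f * x * e + f * x * f"
  by (simp add: f_eq algebra_simps)

text \<open>Moving an off-diagonal factor to the left exchanges \<open>e\<close> and \<open>f\<close>; used as rewrite rules, these
  equations bring products of Peirce elements to a normal form.\<close>

lemma off_diagonal_swap:
  assumes "e * x * e = 0" "f * x * f = 0"
  shows "e * x = x * f" "f * x = x * e"
    and "e * (x * y) = x * (f * y)" "f * (x * y) = x * (e * y)"
    and "x * e + x * f = x" "x * f + x * e = x"
proof -
  show 1: "e * x = x * f" "f * x = x * e"
    using assms by (simp_all add: f_eq algebra_simps)
  show "e * (x * y) = x * (f * y)" "f * (x * y) = x * (e * y)"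
    by (simp_all flip: mult.assoc add: 1)
  show "x * e + x * f = x" "x * f + x * e = x"
    by (simp_all add: f_eq algebra_simps)
qed

lemma corner_absorb:
  assumes "x = e * x * e"
  shows "e * x = x" "x * e = x" "f * x = 0" "x * f = 0"
proof -
  have "e * (e * x * e) = e * x * e" "e * x * e * e = e * x * e"
    "f * (e * x * e) = 0" "e * x * e * f = 0"
    by (simp_all add: mult.assoc peirce_simps)
  then show "e * x = x" "x * e = x" "f * x = 0" "x * f = 0"
    unfolding assms[symmetric] .
qed

lemma two_power_commute: "2 ^ k * x = x * (2 ^ k :: 'a)"
  using mult_of_nat_commute[of "2 ^ k" x] by simp

lemma two_power_torsion_free:
  assumes "2 ^ k * x = (0 :: 'a)"
  shows "x = 0"
  using assms by (induction k) (auto dest: two_torsion_free simp: mult.assoc)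

lemma two_cancel: "2 ^ k * x = 2 ^ k * y \<Longrightarrow> x = (y :: 'a)"
  using two_power_torsion_free[of k "x - y"] by (simp add: algebra_simps)

lemma two_power_left_commute: "x * (2 ^ k * z) = 2 ^ k * (x * z :: 'a)"
  by (metis mult.assoc two_power_commute)

lemmas pull_two_power = two_power_left_commute[of e] two_power_left_commute[of f]

text \<open>Multiplication by \<open>e\<close> has the eigenvalues \<open>2\<close>, \<open>1\<close> and \<open>0\<close> on the corner of \<open>e\<close>, the
  off-diagonal part and the corner of \<open>f\<close>. The last summand is there because \<open>k = 0\<close> means that
  no factor \<open>e\<close> is applied at all.\<close>

lemma jordan_poly_idempotent:
  "jordan_poly (Suc k) ((\<lambda>_. e)(1 := x)) =
   2 ^ k * (e * x * e) + e * x * f + f * x * e + (if k = 0 then f * x * f else 0)"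
proof (induction k)
  case 0
  show ?case using decompose[of x] by simp
next
  case (Suc k)
  have "jordan_poly (Suc (Suc k)) ((\<lambda>_. e)(1 := x)) =
    (2 ^ k * (e * x * e) + e * x * f + f * x * e + (if k = 0 then f * x * f else 0)) \<circ>\<^sub>J e"
    by (subst jordan_poly_Suc_const) (simp only: Suc)
  also have "\<dots> = 2 ^ Suc k * (e * x * e) + e * x * f + f * x * e"
    by (simp add: jordan_prod_def distrib_left distrib_right mult.assoc peirce_simps
        pull_two_power mult_2)
  finally show ?case by (simp del: jordan_poly.simps fun_upd_apply)
qed

text \<open>The element \<open>e - f\<close> anticommutes with off-diagonal elements, so a single factor already
  removes them; on the two corners the eigenvalues are \<open>2\<close> and \<open>-2\<close>.\<close>

lemma jordan_poly_reflection:
  "jordan_poly (Suc (Suc k)) ((\<lambda>_. e - f)(1 := x)) =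
   2 ^ Suc k * (e * x * e + (- 1) ^ Suc k * (f * x * f))"
proof (induction k)
  case 0
  have "x \<circ>\<^sub>J (e - f) = 2 * (e * x * e - f * x * f)"
    by (simp add: jordan_prod_def f_eq algebra_simps mult_2)
  then show ?case by simp
next
  case (Suc k)
  define s where "s = (- 1) ^ Suc k * (f * x * f)"
  have s: "f * s = s" "s * f = s" "e * s = 0" "s * e = 0"
    unfolding s_def by (cases "even k", simp_all add: mult.assoc peirce_simps)+
  have "jordan_poly (Suc (Suc (Suc k))) ((\<lambda>_. e - f)(1 := x)) =
    (2 ^ Suc k * (e * x * e + s)) \<circ>\<^sub>J (e - f)"
    by (subst jordan_poly_Suc_const) (simp only: Suc s_def)
  also have "\<dots> = 2 ^ Suc (Suc k) * (e * x * e - s)"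
    by (simp add: jordan_prod_def distrib_left distrib_right left_diff_distrib right_diff_distrib
        mult.assoc peirce_simps pull_two_power s mult_2 del: power_Suc)
      (simp add: mult.assoc mult_2 algebra_simps)
  also have "e * x * e - s = e * x * e + (- 1) ^ Suc (Suc k) * (f * x * f)"
    by (simp add: s_def)
  finally show ?case .
qed

lemma jordan_poly_idempotent_eq_zero:
  assumes "n \<ge> 2" "jordan_poly n ((\<lambda>_. e)(1 := u)) = 0"
  shows "e * u * e = 0" "e * u * f = 0" "f * u * e = 0"
proof -
  obtain k where n: "n = Suc (Suc k)"
    using assms(1) by (metis Suc_le_D numeral_2_eq_2 Suc_le_mono)
  have v: "2 ^ Suc k * (e * u * e) + e * u * f + f * u * e = 0" (is "?v = 0")
    using assms(2) unfolding n jordan_poly_idempotent by simp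
  have "2 ^ Suc k * (e * u * e) = e * ?v * e" "e * u * f = e * ?v * f" "f * u * e = f * ?v * e"
    by (simp_all add: distrib_left distrib_right mult.assoc peirce_simps pull_two_power
        del: power_Suc)
  then have "2 ^ Suc k * (e * u * e) = 0" and "e * u * f = 0" "f * u * e = 0"
    unfolding v by simp_all
  then show "e * u * e = 0" "e * u * f = 0" "f * u * e = 0"
    using two_power_torsion_free[of "Suc k" "e * u * e"] by auto
qed

lemma jordan_poly_reflection_eq_zero:
  assumes "n \<ge> 2" "jordan_poly n ((\<lambda>_. e - f)(1 := u)) = 0"
  shows "e * u * e = 0" "f * u * f = 0"
proof -
  obtain k where n: "n = Suc (Suc k)"
    using assms(1) by (metis Suc_le_D numeral_2_eq_2 Suc_le_mono)
  have v: "e * u * e + (- 1) ^ Suc k * (f * u * f) = 0" (is "?v = 0")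
    using assms(2) unfolding n jordan_poly_reflection by (rule two_power_torsion_free)
  have "e * u * e = e * ?v * e"
    by (cases "even k") (simp_all add: distrib_left distrib_right left_diff_distrib
        right_diff_distrib mult.assoc peirce_simps)
  moreover have "f * u * f = f * ((- 1) ^ Suc k * ?v) * f"
    by (cases "even k") (simp_all add: distrib_left distrib_right left_diff_distrib
        right_diff_distrib mult.assoc peirce_simps)
  ultimately show "e * u * e = 0" "f * u * f = 0"
    unfolding v by simp_all
qed

end

section \<open>Additivity of multiplicative Jordan derivations\<close>

locale peirce_jordan_derivation = peirce_pair e f for e f :: "'a::ring_1" +
  fixes n :: nat and \<delta> :: "'a \<Rightarrow> 'a"
  assumes n: "n \<ge> 2" and \<delta>: "mult_jordan_derivation n \<delta>"
begin

abbreviation "U \<equiv> additivity_defect \<delta>"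

lemma swap_derivation: "peirce_jordan_derivation f e n \<delta>"
  using swap n \<delta> by (simp add: peirce_jordan_derivation_def peirce_jordan_derivation_axioms_def)

lemma zero: "\<delta> 0 = 0"
  using mult_jordan_derivation_zero[OF \<delta> n] .

lemma U_zero [simp]: "U x 0 = 0" "U 0 x = 0"
  by (simp_all add: additivity_defect_def zero)

lemma \<delta>_add_of_U: "U x y = 0 \<Longrightarrow> \<delta> (x + y) = \<delta> x + \<delta> y"
  by (simp add: additivity_defect_def algebra_simps)

lemma U_jordan_poly:
  "U (jordan_poly n ((\<lambda>_. c)(1 := x))) (jordan_poly n ((\<lambda>_. c)(1 := y))) =
   jordan_poly n ((\<lambda>_. c)(1 := U x y))"
  using additivity_defect_jordan_poly[OF \<delta>, of 1] n by simp

lemma U_idempotent: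
  assumes "U (jordan_poly n ((\<lambda>_. e)(1 := x))) (jordan_poly n ((\<lambda>_. e)(1 := y))) = 0"
  shows "e * U x y * e = 0" "e * U x y * f = 0" "f * U x y * e = 0"
  using jordan_poly_idempotent_eq_zero[OF n] assms unfolding U_jordan_poly by blast+

lemma U_reflection:
  assumes "U (jordan_poly n ((\<lambda>_. e - f)(1 := x))) (jordan_poly n ((\<lambda>_. e - f)(1 := y))) = 0"
  shows "e * U x y * e = 0" "f * U x y * f = 0"
  using jordan_poly_reflection_eq_zero[OF n] assms unfolding U_jordan_poly by blast+

lemma U_eq_zeroI:
  assumes "e * U x y * e = 0" "e * U x y * f = 0" "f * U x y * e = 0" "f * U x y * f = 0"
  shows "U x y = 0"
  using decompose[of "U x y"] assms by simp

lemma eval_idempotent: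
  "jordan_poly n ((\<lambda>_. e)(1 := x)) = 2 ^ (n - 1) * (e * x * e) + e * x * f + f * x * e"
proof -
  have "n = Suc (n - 1)" "n - 1 \<noteq> 0" using n by auto
  then show ?thesis using jordan_poly_idempotent[of "n - 1" x] by simp
qed

lemma eval_reflection:
  "jordan_poly n ((\<lambda>_. e - f)(1 := x)) =
   2 ^ (n - 1) * (e * x * e + (- 1) ^ (n - 1) * (f * x * f))"
proof -
  have "n = Suc (Suc (n - 2))" "n - 1 = Suc (n - 2)" using n by auto
  then show ?thesis using jordan_poly_reflection[of "n - 2" x] by simp
qed

text \<open>Filling with \<open>f\<close> annihilates \<open>x\<close> and filling with \<open>e - f\<close> annihilates \<open>y\<close>. The two
  fillings together detect all four Peirce components of the defect.\<close>

lemma U_corner_off_diagonal: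
  assumes x: "x = e * x * e" and y: "e * y * e = 0" "f * y * f = 0"
  shows "U x y = 0"
proof -
  interpret sw: peirce_jordan_derivation f e n \<delta> by (rule swap_derivation)
  have xs: "f * x * f = 0" "e * x * f = 0" "f * x * e = 0"
    by (subst x, simp add: mult.assoc peirce_simps)+
  show ?thesis
  proof (rule U_eq_zeroI)
    have "jordan_poly n ((\<lambda>_. e - f)(1 := y)) = 0"
      by (simp add: eval_reflection y)
    then show "e * U x y * e = 0"
      by (intro U_reflection) simp
    have "jordan_poly n ((\<lambda>_. f)(1 := x)) = 0"
      by (simp add: sw.eval_idempotent xs)
    then have "U (jordan_poly n ((\<lambda>_. f)(1 := x))) (jordan_poly n ((\<lambda>_. f)(1 := y))) = 0"
      by simp
    from sw.U_idempotent[OF this]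
    show "e * U x y * f = 0" "f * U x y * e = 0" "f * U x y * f = 0"
      by simp_all
  qed
qed

text \<open>Here filling with \<open>f\<close> annihilates \<open>x\<close>, and filling with \<open>e\<close> annihilates \<open>y\<close>.\<close>

lemma U_corners:
  assumes x: "x = e * x * e" and y: "y = f * y * f"
  shows "U x y = 0"
proof -
  interpret sw: peirce_jordan_derivation f e n \<delta> by (rule swap_derivation)
  have xs: "f * x * f = 0" "e * x * f = 0" "f * x * e = 0"
    by (subst x, simp add: mult.assoc peirce_simps)+
  have ys: "e * y * e = 0" "e * y * f = 0" "f * y * e = 0"
    by (subst y, simp add: mult.assoc peirce_simps)+
  have "jordan_poly n ((\<lambda>_. e)(1 := y)) = 0" "jordan_poly n ((\<lambda>_. f)(1 := x)) = 0"
    by (simp_all add: eval_idempotent sw.eval_idempotent xs ys)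
  then show ?thesis
    using U_idempotent[of x y] sw.U_idempotent[of x y] by (intro U_eq_zeroI) simp_all
qed

text \<open>Filling with \<open>e - f\<close> annihilates \<open>y\<close>, which settles the corners of the defect. Filling with
  \<open>e\<close> turns \<open>x\<close> into an element of a corner and leaves \<open>y\<close> off-diagonal; there the defect is
  known to vanish.\<close>

lemma U_diagonal_off_diagonal:
  assumes x: "e * x * f = 0" "f * x * e = 0" and y: "e * y * e = 0" "f * y * f = 0"
  shows "U x y = 0"
proof (rule U_eq_zeroI)
  have "jordan_poly n ((\<lambda>_. e - f)(1 := y)) = 0"
    by (simp add: eval_reflection y)
  then show "e * U x y * e = 0" "f * U x y * f = 0"
    using U_reflection[of x y] by simp_all
  have "U (2 ^ (n - 1) * (e * x * e)) (e * y * f + f * y * e) = 0"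
    by (rule U_corner_off_diagonal)
      (simp_all add: distrib_left distrib_right mult.assoc peirce_simps pull_two_power)
  then have "U (jordan_poly n ((\<lambda>_. e)(1 := x))) (jordan_poly n ((\<lambda>_. e)(1 := y))) = 0"
    by (simp add: eval_idempotent x y)
  from U_idempotent[OF this]
  show "e * U x y * f = 0" "f * U x y * e = 0" by auto
qed

lemma \<delta>_decompose: "\<delta> x = \<delta> (e * x * e) + \<delta> (f * x * f) + \<delta> (e * x * f + f * x * e)"
proof -
  have "\<delta> x = \<delta> ((e * x * e + f * x * f) + (e * x * f + f * x * e))"
    by (subst decompose) (simp only: add_ac)
  also have "\<dots> = \<delta> (e * x * e + f * x * f) + \<delta> (e * x * f + f * x * e)"
    by (intro \<delta>_add_of_U U_diagonal_off_diagonal)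
      (simp_all add: distrib_left distrib_right mult.assoc peirce_simps)
  also have "\<delta> (e * x * e + f * x * f) = \<delta> (e * x * e) + \<delta> (f * x * f)"
    by (intro \<delta>_add_of_U U_corners) (simp_all add: mult.assoc peirce_simps)
  finally show ?thesis .
qed

text \<open>Two free slots are needed to write sums as products. The remaining slots hold \<open>e\<close> because it
  fixes off-diagonal elements, so that \<open>Q x y = x \<circ> y\<close> whenever \<open>x \<circ> y\<close> is off-diagonal, for every
  \<open>n\<close>.\<close>

definition Q :: "'a \<Rightarrow> 'a \<Rightarrow> 'a"
  where "Q x y = jordan_poly n ((\<lambda>_. e)(1 := x, 2 := y))"

lemma Q_eq:
  "Q x y = 2 ^ (n - 2) * (e * (x \<circ>\<^sub>J y) * e) + e * (x \<circ>\<^sub>J y) * f + f * (x \<circ>\<^sub>J y) * e +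
     (if n = 2 then f * (x \<circ>\<^sub>J y) * f else 0)"
proof -
  have "n = Suc (Suc (n - 2))" "n = 2 \<longleftrightarrow> n - 2 = 0" using n by auto
  then show ?thesis
    unfolding Q_def
    using jordan_poly_merge_first_two[of "n - 2" e x y] jordan_poly_idempotent[of "n - 2" "x \<circ>\<^sub>J y"]
    by simp
qed

lemma U_Q_left: "U (Q x z) (Q y z) = Q (U x y) z"
  using additivity_defect_jordan_poly[OF \<delta>, of 1 "(\<lambda>_. e)(2 := z)" x y] n
  by (simp add: Q_def fun_upd_twist)

lemma Q_commute: "Q x y = Q y x"
  by (simp add: Q_eq jordan_prod_def add.commute)

lemma Q_zero: "Q 0 x = 0"
  by (simp add: Q_eq jordan_prod_def)

lemma Q_add: "Q (x + y) z = Q x z + Q y z"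
  by (simp add: Q_eq jordan_prod_def algebra_simps)

lemma Q_add_right: "Q z (x + y) = Q z x + Q z y"
  by (metis Q_add Q_commute)

lemma \<delta>_Q_add:
  assumes "U x x' = 0"
  shows "\<delta> (Q (x + x') y) = \<delta> (Q x y) + \<delta> (Q x' y)"
  unfolding Q_add by (rule \<delta>_add_of_U) (simp add: U_Q_left assms Q_zero)

text \<open>The identity \<open>(e + x) \<circ> (f + y) = x + y + x \<circ> y\<close> expresses \<open>x + y\<close>, up to the diagonal element
  \<open>x \<circ> y\<close>, as a product of two sums on which \<open>\<delta>\<close> is already known to be additive. The
  remaining factors \<open>e\<close> keep this shape: they fix \<open>x + y\<close> and leave the rest diagonal.
  Expanding the product by transport of the defect in each factor shows that \<open>\<delta>\<close> splits.\<close>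

lemma U_off_diagonal:
  assumes x: "e * x * e = 0" "f * x * f = 0" and y: "e * y * e = 0" "f * y * f = 0"
  shows "U x y = 0"
proof -
  interpret sw: peirce_jordan_derivation f e n \<delta> by (rule swap_derivation)
  note swap_x = off_diagonal_swap[OF x] and swap_y = off_diagonal_swap[OF y]
  have "U e x = 0"
    by (rule U_corner_off_diagonal) (simp_all add: x idem)
  have "U f y = 0"
    by (rule sw.U_corner_off_diagonal) (simp_all add: y ff)
  have Qef: "Q e f = 0"
    by (simp add: Q_eq jordan_prod_def ef fe)
  have Qey: "Q e y = y"
    by (simp add: Q_eq jordan_prod_def distrib_left distrib_right mult.assoc peirce_simps swap_y)
  have Qxf: "Q x f = x"
    by (simp add: Q_eq jordan_prod_def distrib_left distrib_right mult.assoc peirce_simps swap_x)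
  have Qxy: "e * Q x y * f = 0" "f * Q x y * e = 0"
    by (simp_all add: Q_eq jordan_prod_def distrib_left distrib_right mult.assoc
        peirce_simps pull_two_power swap_x swap_y)
  have "\<delta> (Q (e + x) (f + y)) = \<delta> (Q e (f + y)) + \<delta> (Q x (f + y))"
    by (rule \<delta>_Q_add) fact
  also have "\<delta> (Q e (f + y)) = \<delta> (Q e f) + \<delta> (Q e y)"
    using \<delta>_Q_add[OF \<open>U f y = 0\<close>, of e] by (simp add: Q_commute)
  also have "\<delta> (Q x (f + y)) = \<delta> (Q x f) + \<delta> (Q x y)"
    using \<delta>_Q_add[OF \<open>U f y = 0\<close>, of x] by (simp add: Q_commute)
  finally have "\<delta> (Q (e + x) (f + y)) = \<delta> x + \<delta> y + \<delta> (Q x y)"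
    by (simp add: Qef Qey Qxf zero)
  moreover have "Q (e + x) (f + y) = Q x y + (x + y)"
    by (simp add: Q_add Q_add_right Qef Qey Qxf)
  moreover have "\<delta> (Q x y + (x + y)) = \<delta> (Q x y) + \<delta> (x + y)"
    by (intro \<delta>_add_of_U U_diagonal_off_diagonal Qxy)
      (simp_all add: x y distrib_left distrib_right)
  ultimately show ?thesis
    by (simp add: additivity_defect_def algebra_simps)
qed

text \<open>Filling with \<open>f\<close> annihilates \<open>x\<close> and \<open>y\<close>, so the defect \<open>u\<close> lies in the corner of \<open>e\<close>. For
  off-diagonal \<open>w\<close> both \<open>x \<circ> w\<close> and \<open>y \<circ> w\<close> are off-diagonal, where \<open>\<delta>\<close> is additive; hence
  \<open>u \<circ> w = 0\<close>. With \<open>w\<close> in a single off-diagonal component one of \<open>u w\<close> and \<open>w u\<close> vanishes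
  anyway, and faithfulness applies.\<close>

lemma U_corner:
  assumes faithful: "corner_faithful e f"
    and x: "x = e * x * e" and y: "y = e * y * e"
  shows "U x y = 0"
proof -
  interpret sw: peirce_jordan_derivation f e n \<delta> by (rule swap_derivation)
  define u where "u = U x y"
  have "jordan_poly n ((\<lambda>_. f)(1 := x)) = 0" "jordan_poly n ((\<lambda>_. f)(1 := y)) = 0"
    by (simp_all add: sw.eval_idempotent corner_absorb[OF x] corner_absorb[OF y])
  then have "e * u * f = 0" "f * u * e = 0" "f * u * f = 0"
    unfolding u_def using sw.U_idempotent[of x y] by simp_all
  then have u: "u = e * u * e"
    using decompose[of u] by simp
  have Qw: "Q z w = z * w + w * z" "e * (z * w + w * z) * e = 0" "f * (z * w + w * z) * f = 0"
    if z: "z = e * z * e" and w: "e * w * e = 0" "f * w * f = 0" for z w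
  proof -
    note z' = corner_absorb[OF z] and w' = off_diagonal_swap[OF w]
    have "z * w * e = 0" "e * w * z = 0"
      using z' w' by (metis mult.assoc mult_zero_left mult_zero_right)+
    moreover have "z * w * f = z * w" "f * w * z = w * z"
      using z' w' by (metis mult.assoc)+
    moreover have "e * z * w = z * w" "w * z * e = w * z" "f * z * w = 0" "w * z * f = 0"
      by (simp_all add: z' mult.assoc)
    ultimately have
      "e * (z * w) = z * w" "f * (z * w) = 0" "z * (w * e) = 0" "z * (w * f) = z * w"
      "e * (w * z) = 0" "f * (w * z) = w * z" "w * (z * e) = w * z" "w * (z * f) = 0"
      by (simp_all add: mult.assoc)
    then show "Q z w = z * w + w * z" "e * (z * w + w * z) * e = 0" "f * (z * w + w * z) * f = 0"
      by (simp_all add: Q_eq jordan_prod_def distrib_left distrib_right mult.assoc)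
  qed
  have kill: "u * w + w * u = 0" if w: "e * w * e = 0" "f * w * f = 0" for w
  proof -
    have "U (Q x w) (Q y w) = 0"
      unfolding Qw(1)[OF x w] Qw(1)[OF y w]
      by (rule U_off_diagonal) (rule Qw(2,3)[OF x w] Qw(2,3)[OF y w])+
    then show ?thesis
      unfolding U_Q_left u_def[symmetric] Qw(1)[OF u w] .
  qed
  have "e * u * e = 0"
  proof (rule corner_faithfulD[OF faithful])
    fix a
    have "e * a * f * u = 0" "u * (f * a * e) = 0"
      using corner_absorb[OF u] by (simp_all add: mult.assoc) (simp flip: mult.assoc)
    then show "e * u * e * (e * a * f) = 0" "f * a * e * (e * u * e) = 0"
      using kill[of "e * a * f"] kill[of "f * a * e"]
      unfolding u[symmetric] by (simp_all add: mult.assoc peirce_simps)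
  qed
  then show ?thesis using u unfolding u_def by simp
qed

theorem mult_jordan_derivation_additive:
  assumes faithful_e: "corner_faithful e f" and faithful_f: "corner_faithful f e"
  shows "Modules.additive \<delta>"
proof
  fix x y
  interpret sw: peirce_jordan_derivation f e n \<delta> by (rule swap_derivation)
  have "\<delta> (e * (x + y) * e) = \<delta> (e * x * e) + \<delta> (e * y * e)"
    unfolding distrib_left distrib_right
    by (intro \<delta>_add_of_U U_corner[OF faithful_e]) (auto simp: mult.assoc peirce_simps)
  moreover have "\<delta> (f * (x + y) * f) = \<delta> (f * x * f) + \<delta> (f * y * f)"
    unfolding distrib_left distrib_right
    by (intro \<delta>_add_of_U sw.U_corner[OF faithful_f]) (auto simp: mult.assoc peirce_simps)
  moreover have "\<delta> (e * (x + y) * f + f * (x + y) * e) =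
      \<delta> ((e * x * f + f * x * e) + (e * y * f + f * y * e))"
    by (simp add: algebra_simps)
  moreover have "\<dots> = \<delta> (e * x * f + f * x * e) + \<delta> (e * y * f + f * y * e)"
    by (intro \<delta>_add_of_U U_off_diagonal)
      (simp_all add: distrib_left distrib_right mult.assoc peirce_simps)
  ultimately show "\<delta> (x + y) = \<delta> x + \<delta> y"
    using \<delta>_decompose[of "x + y"] \<delta>_decompose[of x] \<delta>_decompose[of y] by simp
qed

end

section \<open>Jordan centralizers\<close>

context peirce_pair
begin

text \<open>The inner derivation \<open>d x = m x - x m\<close> has central values, so the derivation rule on \<open>e e = e\<close>
  reads \<open>d e = 2 e (d e)\<close>, which forces \<open>d e = 0\<close>. Hence \<open>d (e a f) = e (d a) f = (d a) e f = 0\<close>: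
  off-diagonal elements commute with \<open>m\<close>. The off-diagonal part is a bimodule over the corners, so
  \<open>d\<close> of a corner element annihilates it, and faithfulness gives \<open>0\<close> there as well.\<close>

lemma central_commutators_imp_central:
  fixes m x :: 'a
  assumes faithful_e: "corner_faithful e f" and faithful_f: "corner_faithful f e"
    and comm: "\<And>x y. (m * x - x * m) * y = y * (m * x - x * m)"
  shows "m * x = x * m"
proof -
  define d where "d x = m * x - x * m" for x
  have d_mult: "d (x * y) = d x * y + x * d y" and d_add: "d (x + y) = d x + d y" for x y
    by (simp_all add: d_def algebra_simps)
  have central: "d x * y = y * d x" for x y
    using comm by (simp add: d_def)
  have "d e = e * d e + e * d e"
    using d_mult[of e e] by (simp add: idem central)
  then have "e * d e = e * (e * d e + e * d e)"
    by simp
  then have "e * d e = 0"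
    by (simp add: distrib_left absorb)
  with \<open>d e = e * d e + e * d e\<close> have de: "d e = 0"
    by simp
  have df: "d f = 0"
    using de by (simp add: d_def f_eq algebra_simps)
  have sandwich: "d (a * x * b) = a * b * d x" if "d a = 0" "d b = 0" for a b x
    using that by (simp add: d_mult mult.assoc central)
  have off: "d (e * a * f) = 0" "d (f * a * e) = 0" for a
    by (simp_all add: sandwich de df ef fe)
  have corner_e: "d (e * x * e) = e * d x * e" and corner_f: "d (f * x * f) = f * d x * f" for x
    by (simp_all add: d_mult de df mult.assoc)
  have "e * d x * e = 0"
  proof (rule corner_faithfulD[OF faithful_e])
    fix a
    show "e * d x * e * (e * a * f) = 0"
      unfolding corner_e[symmetric]
      using d_mult[of "e * x * e" "e * a * f"] off(1)[of a] off(1)[of "x * e * e * a"]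
      by (simp add: mult.assoc)
    show "f * a * e * (e * d x * e) = 0"
      unfolding corner_e[symmetric]
      using d_mult[of "f * a * e" "e * x * e"] off(2)[of a] off(2)[of "a * e * e * x"]
      by (simp add: mult.assoc)
  qed
  moreover have "f * d x * f = 0"
  proof (rule corner_faithfulD[OF faithful_f])
    fix a
    show "f * d x * f * (f * a * e) = 0"
      unfolding corner_f[symmetric]
      using d_mult[of "f * x * f" "f * a * e"] off(2)[of a] off(2)[of "x * f * f * a"]
      by (simp add: mult.assoc)
    show "e * a * f * (f * d x * f) = 0"
      unfolding corner_f[symmetric]
      using d_mult[of "e * a * f" "f * x * f"] off(1)[of a] off(1)[of "a * f * f * x"]
      by (simp add: mult.assoc)
  qed
  ultimately have "d x = 0"
    using decompose[of x] by (metis add_0 corner_e corner_f d_add off)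
  then show ?thesis by (simp add: d_def)
qed

text \<open>With \<open>1\<close> in the slots \<open>3, \<dots>, n\<close> the symmetry of the Jordan product shows
  \<open>D x \<circ> y = D y \<circ> x\<close>; for \<open>y = 1\<close> this is \<open>2 D x = m \<circ> x\<close> with \<open>m = D 1\<close>. Inserting this
  into \<open>D (x \<circ> y) = D x \<circ> y\<close> gives \<open>m \<circ> (x \<circ> y) = (m \<circ> x) \<circ> y\<close>, and expanding both sides
  leaves exactly that the commutator of \<open>m\<close> and \<open>y\<close> commutes with \<open>x\<close>.\<close>

lemma jordan_centralizer_is_central_multiplication:
  fixes D :: "'a \<Rightarrow> 'a"
  assumes n: "n \<ge> 2"
    and faithful_e: "corner_faithful e f" and faithful_f: "corner_faithful f e"
    and D: "\<And>t. D (jordan_poly n t) = jordan_poly n (t(1 := D (t 1)))"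
  shows "D 1 \<in> ring_center" "D x = D 1 * x"
proof -
  define m where "m = D 1"
  obtain k where k: "n = Suc (Suc k)"
    using n by (metis Suc_le_D numeral_2_eq_2 Suc_le_mono)
  have D_prod: "D (2 ^ k * (x \<circ>\<^sub>J y)) = 2 ^ k * (D x \<circ>\<^sub>J y)" for x y
    using D[of "(\<lambda>_. 1)(1 := x, 2 := y)"]
      jordan_poly_merge_first_two[of k 1 x y] jordan_poly_merge_first_two[of k 1 "D x" y]
    by (simp add: k jordan_poly_ones fun_upd_twist del: jordan_poly.simps)
  have sym: "D x \<circ>\<^sub>J y = D y \<circ>\<^sub>J x" for x y
    by (rule two_cancel[of k])
      (use D_prod[of x y] D_prod[of y x] in \<open>simp add: jordan_prod_def add.commute\<close>)
  have twice: "2 * D x = m \<circ>\<^sub>J x" for x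
    using sym[of x 1] by (simp add: m_def jordan_prod_def mult_2)
  have pull: "m \<circ>\<^sub>J (2 ^ k * z) = 2 ^ k * (m \<circ>\<^sub>J z)" for z
    by (simp add: jordan_prod_def distrib_left mult.assoc two_power_left_commute[of m])
  \<comment> \<open>The factor \<open>2\<close> is written as a power in order to match \<open>two_cancel\<close>.\<close>
  have "2 ^ 1 * D (2 ^ k * z) = 2 ^ 1 * (2 ^ k * D z)" for z
    using twice[of "2 ^ k * z"] twice[of z] pull[of z]
    by (simp add: mult_2 flip: distrib_left)
  then have D_two_power: "D (2 ^ k * z) = 2 ^ k * D z" for z
    by (rule two_cancel)
  have D_mult: "D (x \<circ>\<^sub>J y) = D x \<circ>\<^sub>J y" for x y
    by (rule two_cancel[of k]) (use D_prod[of x y] D_two_power in simp)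
  have assoc: "m \<circ>\<^sub>J (x \<circ>\<^sub>J y) = (m \<circ>\<^sub>J x) \<circ>\<^sub>J y" for x y
    unfolding twice[symmetric] D_mult
    by (simp add: jordan_prod_def mult_2 distrib_left distrib_right)
  have comm: "(m * y - y * m) * x = x * (m * y - y * m)" for x y
    using assoc[of x y] by (simp add: jordan_prod_def algebra_simps)
  have central: "m * x = x * m" for x
    by (rule central_commutators_imp_central) (fact faithful_e faithful_f comm)+
  then show "D 1 \<in> ring_center"
    by (simp add: ring_center_def m_def)
  have "2 ^ 1 * D x = 2 ^ 1 * (m * x)"
    using twice[of x] by (simp add: jordan_prod_def central[of x] mult_2)
  then show "D x = D 1 * x"
    unfolding m_def by (rule two_cancel)
qed

end

section \<open>Multiplicative generalized Jordan derivations\<close>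

theorem theorem3p1:
  fixes e1 e2 :: "'a::ring_1" and \<Delta> :: "'a \<Rightarrow> 'a" and n :: nat
  assumes "n \<ge> 2"
    and "\<forall>t::'a. 2 * t = 0 \<longrightarrow> t = 0"
    and "e1 * e1 = e1" and "e1 \<noteq> 0" and "e1 \<noteq> 1"
    and "e2 = 1 - e1"
    and "\<forall>t. {e1 * t * e1 * x | x. x \<in> peirce e1 e2} = {0} \<and>
             {x * (e1 * t * e1) | x. x \<in> peirce e2 e1} = {0} \<longrightarrow> e1 * t * e1 = 0"
    and "\<forall>t. {x * (e2 * t * e2) | x. x \<in> peirce e1 e2} = {0} \<and>
             {e2 * t * e2 * x | x. x \<in> peirce e2 e1} = {0} \<longrightarrow> e2 * t * e2 = 0"
    and "mult_gen_jordan_derivation n \<Delta>"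
  shows "Modules.additive \<Delta> \<and>
    (\<exists>\<mu> \<delta>. \<mu> \<in> ring_center \<and> jordan_derivation n \<delta> \<and> (\<forall>t. \<Delta> t = \<mu> * t + \<delta> t))"
proof -
  interpret peirce_pair e1 e2
    by unfold_locales (use assms(2,3,6) in auto)
  have faithful: "corner_faithful e1 e2" "corner_faithful e2 e1"
    unfolding corner_faithful_def
  proof safe
    fix t
    assume "\<forall>x\<in>peirce e1 e2. e1 * t * e1 * x = 0" "\<forall>x\<in>peirce e2 e1. x * (e1 * t * e1) = 0"
    from this[THEN peirce_image_eq_zero] show "e1 * t * e1 = 0"
      using assms(7)[rule_format, of t] by simp
  next
    fix t
    assume "\<forall>x\<in>peirce e2 e1. e2 * t * e2 * x = 0" "\<forall>x\<in>peirce e1 e2. x * (e2 * t * e2) = 0"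
    from this[THEN peirce_image_eq_zero] show "e2 * t * e2 = 0"
      using assms(8)[rule_format, of t] by simp
  qed
  obtain \<delta> where \<delta>: "mult_jordan_derivation n \<delta>"
    and \<Delta>: "\<And>t. \<Delta> (jordan_poly n t) = jordan_poly n (t(1 := \<Delta> (t 1))) +
        (\<Sum>i = 2..n. jordan_poly n (t(i := \<delta> (t i))))"
    using assms(9) unfolding mult_gen_jordan_derivation_def by blast
  interpret peirce_jordan_derivation e1 e2 n \<delta>
    by unfold_locales (fact assms(1) \<delta>)+
  have additive_\<delta>: "Modules.additive \<delta>"
    by (rule mult_jordan_derivation_additive[OF faithful])
  \<comment> \<open>The summands for the slots \<open>2, \<dots>, n\<close> are the same for \<open>\<Delta>\<close> and \<open>\<delta>\<close> and cancel.\<close>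
  define D where "D x = \<Delta> x - \<delta> x" for x
  have D: "D (jordan_poly n t) = jordan_poly n (t(1 := D (t 1)))" for t
  proof -
    have "\<delta> (jordan_poly n t) = (\<Sum>i = 1..n. jordan_poly n (t(i := \<delta> (t i))))"
      using \<delta> unfolding mult_jordan_derivation_def by blast
    also have "\<dots> = jordan_poly n (t(1 := \<delta> (t 1))) +
        (\<Sum>i = 2..n. jordan_poly n (t(i := \<delta> (t i))))"
      using assms(1) by (subst sum.atLeast_Suc_atMost) (auto simp: numeral_2_eq_2)
    finally show ?thesis
      using assms(1) by (simp add: D_def \<Delta> jordan_poly_diff)
  qed
  have "D 1 \<in> ring_center" and D_eq: "D x = D 1 * x" for x
    by (fact jordan_centralizer_is_central_multiplication[OF assms(1) faithful D])+
  moreover have \<Delta>_eq: "\<Delta> x = D 1 * x + \<delta> x" for x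
    using D_eq[of x] by (simp add: D_def diff_eq_eq)
  moreover have "Modules.additive \<Delta>"
  proof
    fix x y
    show "\<Delta> (x + y) = \<Delta> x + \<Delta> y"
      unfolding \<Delta>_eq[of "x + y"] \<Delta>_eq[of x] \<Delta>_eq[of y] additive.add[OF additive_\<delta>]
      by (simp add: distrib_left)
  qed
  ultimately show ?thesis
    using \<delta> additive_\<delta> unfolding jordan_derivation_def by blast
qed

end
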